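(* Let $q_0>0$ satisfy $$\frac{(T_0-T_{0l})k_l}{\sqrt{\pi \alpha_l}}<q_0<\frac{(T_0-T_{0s})k_l}{\sqrt{\pi \alpha_l}},$$ and let $s(t)=2\lambda\sqrt{\alpha_s t}$, $T_k$, $T_s,T_l,C_s,C_l$ be the similarity solution of problem $(P_1)$ given in the context. Put $$\widetilde T_1=T_s(0,t)=T_k-\frac{q_0}{k_s}\sqrt{\alpha_s\pi}\,\mathrm{erf}(\lambda).$$ If in the Rubinstein solution $\widetilde s(t)=2\mu\sqrt{\alpha_s t}$, $\widetilde T_k$, $\widetilde T_s,\widetilde T_l,\widetilde C_s,\widetilde C_l$ of problem $(P_R)$ (see the context) one takes $T_1=\widetilde T_1$, then the two free boundary problems $(P_1)$ and $(P_R)$ are equivalent, that is, $$\mu=\lambda,\quad \widetilde T_k=T_k,$$ $$T_s(x,t)=\widetilde T_s(x,t),\quad T_l(x,t)=\widetilde T_l(x,t),\quad C_s(x,t)=\widetilde C_s(x,t),\quad C_l(x,t)=\widetilde C_l(x,t).$$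
   Context: Data. $\alpha_s,\alpha_l,d_s,d_l,k_s,k_l,\rho,\gamma$ are positive constants (subscripts $s$, $l$: solid, liquid). $T_A<T_B$ are real numbers, and $f_l,f_s:[T_A,T_B]\to\mathbb R$ are continuous strictly increasing functions with $$f_l(T_A)=f_s(T_A)<f_l(T)<f_s(T)<f_l(T_B)=f_s(T_B),\quad T_A<T<T_B.$$ $C_0$ is a constant with $f_l(T_A)<C_0<f_l(T_B)$, and $T_{0l}=f_l^{-1}(C_0)$, $T_{0s}=f_s^{-1}(C_0)$. $T_0$ is a constant with $T_A<T_0<T_B$. The alloy is initially liquid, i.e. $C_0<f_l(T_0)$. Problem $(P_1)$. Find $s(t)>0$ ($t>0$), a constant $T_k\in(T_A,T_B)$, functions $T_s,C_s$ on $0<x<s(t)$, $t>0$, and $T_l,C_l$ on $x>s(t)$, $t>0$, such that, for all $t>0$: (i) $\alpha_s T_{s,xx}=T_{s,t}$ for $0<x<s(t)$; (ii) $\alpha_l T_{l,xx}=T_{l,t}$ for $x>s(t)$; (iii) $d_s C_{s,xx}=C_{s,t}$ for $0<x<s(t)$; (iv) $d_l C_{l,xx}=C_{l,t}$ for $x>s(t)$; (v) $k_s T_{s,x}(0,t)=q_0/\sqrt t$; (vi) $T_s(s(t),t)=T_l(s(t),t)=T_k$; (vii) $T_l(x,0)=T_0$ for $x>0$; (viii) $T_l(\infty,t)=T_0$; (ix) $C_{s,x}(0,t)=0$; (x) $C_s(s(t),t)=f_s(T_k)$; (xi) $C_l(x,0)=C_0$ for $x>0$; (xii) $C_l(s(t),t)=f_l(T_k)$;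 (xiii) $k_sT_{s,x}(s(t),t)-k_lT_{l,x}(s(t),t)=\gamma\rho s'(t)$; (xiv) $d_lC_{l,x}(s(t),t)-d_sC_{s,x}(s(t),t)=[f_s(T_k)-f_l(T_k)]s'(t)$. Problem $(P_R)$ is obtained from $(P_1)$ by replacing (v) by the condition that the solid temperature at $x=0$ equals a constant $T_1$ for all $t>0$. Functions. $\mathrm{erf}(x)=\frac{2}{\sqrt\pi}\int_0^x e^{-t^2}dt$, $\mathrm{erfc}=1-\mathrm{erf}$; write $c=\sqrt{\alpha_s/\alpha_l}$. For $x>0$: $$Q(x)=\sqrt{\pi}\,x e^{x^2}\mathrm{erfc}(x),\quad Q_1(x)=\sqrt\pi\,xe^{x^2}\mathrm{erf}(x),\quad F_1(x)=e^{x^2}\mathrm{erfc}(x),\quad M(x)=\Big[Q\big(\sqrt{\alpha_s/d_l}\,x\big)\Big]^{-1},$$ $$F(x)=T_0+\frac{\gamma\rho\alpha_l}{k_l}Q(cx)-\frac{q_0}{k_l}\sqrt{\alpha_l\pi}\,e^{-x^2}F_1(cx),$$ $$G(x)=\frac{\gamma\rho\alpha_s\alpha_lQ_1(x)Q(cx)+T_1k_s\alpha_lQ(cx)+T_0k_l\alpha_sQ_1(x)}{k_s\alpha_lQ(cx)+k_l\alpha_sQ_1(x)},$$ and $\phi(x)=\frac{f_s(x)-f_l(x)}{C_0-f_l(x)}$ for $x\in(T_A,T_{0l})\cup(T_{0l},T_B)$. Similarity solution of $(P_1)$ (under the stated bounds on $q_0$): $s(t)=2\lambda\sqrt{\alpha_st}$,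 $$T_s=T_k-\frac{q_0}{k_s}\sqrt{\pi\alpha_s}\,\mathrm{erf}(\lambda)+\frac{q_0}{k_s}\sqrt{\pi\alpha_s}\,\mathrm{erf}\Big(\frac{x}{2\sqrt{\alpha_st}}\Big),\quad T_l=T_0+\frac{T_k-T_0}{\mathrm{erfc}(c\lambda)}\mathrm{erfc}\Big(\frac{x}{2\sqrt{\alpha_lt}}\Big),$$ $$C_s=f_s(T_k),\quad C_l=C_0+\frac{f_l(T_k)-C_0}{\mathrm{erfc}(\sqrt{\alpha_s/d_l}\,\lambda)}\mathrm{erfc}\Big(\frac{x}{2\sqrt{d_lt}}\Big),$$ where $(\lambda,T_k)$ is the unique pair with $T_k=F(\lambda)$, $M(\lambda)=\phi(T_k)$, $\lambda>0$, $T_A<T_k<T_B$. Rubinstein solution of $(P_R)$: $\widetilde s(t)=2\mu\sqrt{\alpha_st}$, $$\widetilde T_s=T_1+\frac{\widetilde T_k-T_1}{\mathrm{erf}(\mu)}\mathrm{erf}\Big(\frac{x}{2\sqrt{\alpha_st}}\Big),\quad \widetilde T_l=T_0+\frac{\widetilde T_k-T_0}{\mathrm{erfc}(c\mu)}\mathrm{erfc}\Big(\frac{x}{2\sqrt{\alpha_lt}}\Big),$$ $$\widetilde C_s=f_s(\widetilde T_k),\quad \widetilde C_l=C_0+\frac{f_l(\widetilde T_k)-C_0}{\mathrm{erfc}(\sqrt{\alpha_s/d_l}\,\mu)}\mathrm{erfc}\Big(\frac{x}{2\sqrt{d_lt}}\Big),$$ where $(\mu,\widetilde T_k)$ is the (unique)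 pair with $\widetilde T_k=G(\mu)$, $M(\mu)=\phi(\widetilde T_k)$, $\mu>0$, $T_A<\widetilde T_k<T_B$. Solid functions are defined on $0<x<s(t)$ (resp. $\widetilde s(t)$), liquid functions on $x>s(t)$ (resp. $\widetilde s(t)$), $t>0$. *)

theory Defs
  imports "HOL-Analysis.Analysis"
begin

definition erf :: "real \<Rightarrow> real" where
  "erf x = 2 / sqrt pi * (LBINT t=0..x. exp (- (t\<^sup>2)))"

definition erfc :: "real \<Rightarrow> real" where
  "erfc x = 1 - erf x"

record alloy =
  alpha_s :: real
  alpha_l :: real
  d_s :: real
  d_l :: real
  k_s :: real
  k_l :: real
  rho :: real
  gam :: real
  T_A :: real
  T_B :: real
  f_l :: "real \<Rightarrow> real"
  f_s :: "real \<Rightarrow> real"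
  C_0 :: real
  T_0 :: real

text \<open>The liquidus and solidus are functions on the interval from T_A to T_B; their values
  elsewhere are irrelevant. The last condition says that the alloy is initially liquid.\<close>

definition alloy_data :: "alloy \<Rightarrow> bool" where
  "alloy_data A \<longleftrightarrow>
     0 < alpha_s A \<and> 0 < alpha_l A \<and> 0 < d_s A \<and> 0 < d_l A \<and>
     0 < k_s A \<and> 0 < k_l A \<and> 0 < rho A \<and> 0 < gam A \<and>
     T_A A < T_B A \<and>
     continuous_on {T_A A..T_B A} (f_l A) \<and> continuous_on {T_A A..T_B A} (f_s A) \<and>
     strict_mono_on {T_A A..T_B A} (f_l A) \<and> strict_mono_on {T_A A..T_B A} (f_s A) \<and>
     f_l A (T_A A) = f_s A (T_A A) \<and> f_l A (T_B A) = f_s A (T_B A) \<and>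
     (\<forall>T. T_A A < T \<and> T < T_B A \<longrightarrow>
        f_l A (T_A A) < f_l A T \<and> f_l A T < f_s A T \<and> f_s A T < f_l A (T_B A)) \<and>
     f_l A (T_A A) < C_0 A \<and> C_0 A < f_l A (T_B A) \<and>
     T_A A < T_0 A \<and> T_0 A < T_B A \<and>
     C_0 A < f_l A (T_0 A)"

definition T_0l :: "alloy \<Rightarrow> real" where
  "T_0l A = the_inv_into {T_A A..T_B A} (f_l A) (C_0 A)"

definition T_0s :: "alloy \<Rightarrow> real" where
  "T_0s A = the_inv_into {T_A A..T_B A} (f_s A) (C_0 A)"


subsection \<open>The free boundary problems\<close>

text \<open>Here v is the space derivative of u(., t) near x, and w is the second one at x.\<close>

definition heat_eq_at :: "real \<Rightarrow> (real \<Rightarrow> real \<Rightarrow> real) \<Rightarrow> real \<Rightarrow> real \<Rightarrow> bool" where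
  "heat_eq_at a u x t \<longleftrightarrow>
     (\<exists>v w. (\<forall>\<^sub>F y in nhds x. ((\<lambda>z. u z t) has_real_derivative v y) (at y)) \<and>
            (v has_real_derivative w) (at x) \<and>
            ((\<lambda>\<tau>. u x \<tau>) has_real_derivative a * w) (at t))"

abbreviation dx :: "(real \<Rightarrow> real \<Rightarrow> real) \<Rightarrow> real \<Rightarrow> real \<Rightarrow> real" where
  "dx u t x \<equiv> deriv (\<lambda>z. u z t) x"

text \<open>All conditions shared by the two problems, that is, everything except the thermal condition
  on the fixed face. Values and fluxes on the fixed face, on the free boundary and at time zero
  are limits from inside the phase concerned, because the unknowns are only meant on the open
  phase regions. That the free boundary starts at the origin is implicit in the initial
  conditions, which concern every positive x.\<close>

definition solidification :: "alloy \<Rightarrow> (real \<Rightarrow> real) \<Rightarrow> real \<Rightarrow>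
    (real \<Rightarrow> real \<Rightarrow> real) \<Rightarrow> (real \<Rightarrow> real \<Rightarrow> real) \<Rightarrow>
    (real \<Rightarrow> real \<Rightarrow> real) \<Rightarrow> (real \<Rightarrow> real \<Rightarrow> real) \<Rightarrow> bool" where
  "solidification A s Tk Ts Tl Cs Cl \<longleftrightarrow>
     T_A A < Tk \<and> Tk < T_B A \<and>
     (\<forall>t>0. 0 < s t) \<and> (s \<longlongrightarrow> 0) (at_right 0) \<and>
     (\<forall>t>0. \<forall>x. 0 < x \<and> x < s t \<longrightarrow>
        heat_eq_at (alpha_s A) Ts x t \<and> heat_eq_at (d_s A) Cs x t) \<and>
     (\<forall>t>0. \<forall>x. s t < x \<longrightarrow>
        heat_eq_at (alpha_l A) Tl x t \<and> heat_eq_at (d_l A) Cl x t) \<and>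
     (\<forall>x>0. ((\<lambda>t. Tl x t) \<longlongrightarrow> T_0 A) (at_right 0) \<and>
            ((\<lambda>t. Cl x t) \<longlongrightarrow> C_0 A) (at_right 0)) \<and>
     (\<forall>t>0.
        ((\<lambda>x. Ts x t) \<longlongrightarrow> Tk) (at_left (s t)) \<and>
        ((\<lambda>x. Tl x t) \<longlongrightarrow> Tk) (at_right (s t)) \<and>
        ((\<lambda>x. Tl x t) \<longlongrightarrow> T_0 A) at_top \<and>
        (dx Cs t \<longlongrightarrow> 0) (at_right 0) \<and>
        ((\<lambda>x. Cs x t) \<longlongrightarrow> f_s A Tk) (at_left (s t)) \<and>
        ((\<lambda>x. Cl x t) \<longlongrightarrow> f_l A Tk) (at_right (s t)) \<and>
        (\<exists>s' Tsx Tlx Csx Clx.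
           (s has_real_derivative s') (at t) \<and>
           (dx Ts t \<longlongrightarrow> Tsx) (at_left (s t)) \<and>
           (dx Tl t \<longlongrightarrow> Tlx) (at_right (s t)) \<and>
           (dx Cs t \<longlongrightarrow> Csx) (at_left (s t)) \<and>
           (dx Cl t \<longlongrightarrow> Clx) (at_right (s t)) \<and>
           k_s A * Tsx - k_l A * Tlx = gam A * rho A * s' \<and>
           d_l A * Clx - d_s A * Csx = (f_s A Tk - f_l A Tk) * s'))"

definition problem_P1 :: "alloy \<Rightarrow> real \<Rightarrow> (real \<Rightarrow> real) \<Rightarrow> real \<Rightarrow>
    (real \<Rightarrow> real \<Rightarrow> real) \<Rightarrow> (real \<Rightarrow> real \<Rightarrow> real) \<Rightarrow>
    (real \<Rightarrow> real \<Rightarrow> real) \<Rightarrow> (real \<Rightarrow> real \<Rightarrow> real) \<Rightarrow> bool" where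
  "problem_P1 A q0 s Tk Ts Tl Cs Cl \<longleftrightarrow>
     solidification A s Tk Ts Tl Cs Cl \<and>
     (\<forall>t>0. ((\<lambda>x. k_s A * dx Ts t x) \<longlongrightarrow> q0 / sqrt t) (at_right 0))"

definition problem_PR :: "alloy \<Rightarrow> real \<Rightarrow> (real \<Rightarrow> real) \<Rightarrow> real \<Rightarrow>
    (real \<Rightarrow> real \<Rightarrow> real) \<Rightarrow> (real \<Rightarrow> real \<Rightarrow> real) \<Rightarrow>
    (real \<Rightarrow> real \<Rightarrow> real) \<Rightarrow> (real \<Rightarrow> real \<Rightarrow> real) \<Rightarrow> bool" where
  "problem_PR A T1 s Tk Ts Tl Cs Cl \<longleftrightarrow>
     solidification A s Tk Ts Tl Cs Cl \<and>
     (\<forall>t>0. ((\<lambda>x. Ts x t) \<longlongrightarrow> T1) (at_right 0))"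


subsection \<open>The auxiliary functions\<close>

definition Q :: "real \<Rightarrow> real" where
  "Q x = sqrt pi * x * exp (x\<^sup>2) * erfc x"

definition Q\<^sub>1 :: "real \<Rightarrow> real" where
  "Q\<^sub>1 x = sqrt pi * x * exp (x\<^sup>2) * erf x"

definition F\<^sub>1 :: "real \<Rightarrow> real" where
  "F\<^sub>1 x = exp (x\<^sup>2) * erfc x"

definition c :: "alloy \<Rightarrow> real" where
  "c A = sqrt (alpha_s A / alpha_l A)"

definition M :: "alloy \<Rightarrow> real \<Rightarrow> real" where
  "M A x = inverse (Q (sqrt (alpha_s A / d_l A) * x))"

definition F :: "alloy \<Rightarrow> real \<Rightarrow> real \<Rightarrow> real" where
  "F A q0 x = T_0 A + gam A * rho A * alpha_l A / k_l A * Q (c A * x)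
     - q0 / k_l A * sqrt (alpha_l A * pi) * exp (- (x\<^sup>2)) * F\<^sub>1 (c A * x)"

definition G :: "alloy \<Rightarrow> real \<Rightarrow> real \<Rightarrow> real" where
  "G A T1 x =
     (gam A * rho A * alpha_s A * alpha_l A * Q\<^sub>1 x * Q (c A * x)
      + T1 * k_s A * alpha_l A * Q (c A * x) + T_0 A * k_l A * alpha_s A * Q\<^sub>1 x)
     / (k_s A * alpha_l A * Q (c A * x) + k_l A * alpha_s A * Q\<^sub>1 x)"

definition \<phi> :: "alloy \<Rightarrow> real \<Rightarrow> real" where
  "\<phi> A x = (f_s A x - f_l A x) / (C_0 A - f_l A x)"


subsection \<open>The explicit solutions\<close>

text \<open>The condition Tk \<noteq> T_0l A expresses that Tk lies in the domain of \<phi>.\<close>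

definition similarity_pair :: "alloy \<Rightarrow> real \<Rightarrow> real \<Rightarrow> real \<Rightarrow> bool" where
  "similarity_pair A q0 lam Tk \<longleftrightarrow>
     0 < lam \<and> T_A A < Tk \<and> Tk < T_B A \<and> Tk \<noteq> T_0l A \<and>
     Tk = F A q0 lam \<and> M A lam = \<phi> A Tk"

definition rubinstein_pair :: "alloy \<Rightarrow> real \<Rightarrow> real \<Rightarrow> real \<Rightarrow> bool" where
  "rubinstein_pair A T1 mu Tk \<longleftrightarrow>
     0 < mu \<and> T_A A < Tk \<and> Tk < T_B A \<and> Tk \<noteq> T_0l A \<and>
     Tk = G A T1 mu \<and> M A mu = \<phi> A Tk"

definition front :: "alloy \<Rightarrow> real \<Rightarrow> real \<Rightarrow> real" where
  "front A lam t = 2 * lam * sqrt (alpha_s A * t)"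

definition similarity_Ts :: "alloy \<Rightarrow> real \<Rightarrow> real \<Rightarrow> real \<Rightarrow> real \<Rightarrow> real \<Rightarrow> real" where
  "similarity_Ts A q0 lam Tk x t =
     Tk - q0 / k_s A * sqrt (pi * alpha_s A) * erf lam
     + q0 / k_s A * sqrt (pi * alpha_s A) * erf (x / (2 * sqrt (alpha_s A * t)))"

definition rubinstein_Ts :: "alloy \<Rightarrow> real \<Rightarrow> real \<Rightarrow> real \<Rightarrow> real \<Rightarrow> real \<Rightarrow> real" where
  "rubinstein_Ts A T1 mu Tk x t =
     T1 + (Tk - T1) / erf mu * erf (x / (2 * sqrt (alpha_s A * t)))"

text \<open>The remaining three profiles have the same form in both solutions and differ only through
  the similarity coefficient and the critical temperature.\<close>

definition profile_Tl :: "alloy \<Rightarrow> real \<Rightarrow> real \<Rightarrow> real \<Rightarrow> real \<Rightarrow> real" where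
  "profile_Tl A lam Tk x t =
     T_0 A + (Tk - T_0 A) / erfc (c A * lam) * erfc (x / (2 * sqrt (alpha_l A * t)))"

definition profile_Cs :: "alloy \<Rightarrow> real \<Rightarrow> real \<Rightarrow> real \<Rightarrow> real" where
  "profile_Cs A Tk x t = f_s A Tk"

definition profile_Cl :: "alloy \<Rightarrow> real \<Rightarrow> real \<Rightarrow> real \<Rightarrow> real \<Rightarrow> real" where
  "profile_Cl A lam Tk x t =
     C_0 A + (f_l A Tk - C_0 A) / erfc (sqrt (alpha_s A / d_l A) * lam)
       * erfc (x / (2 * sqrt (d_l A * t)))"

end

theory Submission
  imports "HOL-Probability.Distributions" Defs
begin

text \<open>
The equality of the two solutions comes down to the uniqueness of the Rubinstein pair. Multiply
the equation \<open>Tk = G(\<lambda>)\<close> by the denominator of \<open>G\<close> and insert \<open>T1 = Tk - (q0 / k_s) sqrt(\<pi> \<alpha>_s) erf \<lambda>\<close>: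
what remains is \<open>Tk = F(\<lambda>)\<close>. Both are the heat balance on the front, written with the surface
flux or with the surface temperature as datum. As the second equation \<open>M(\<lambda>) = \<phi>(Tk)\<close> is the same in
both problems, the similarity pair is a Rubinstein pair for this \<open>T1\<close>
(\<open>similarity_imp_rubinstein_pair\<close>).

It is the only one because the two equations are curves in the \<open>(\<mu>, T)\<close>-plane of opposite
monotonicity. On the one hand \<open>Q\<close> increases with values below 1, so \<open>M\<close> decreases with values above 1;
and where \<open>\<phi>\<close> exceeds 1 it is strictly increasing (\<open>phi_strict_mono\<close>). Hence \<open>M(\<mu>) = \<phi>(T)\<close> makes
\<open>T\<close> a decreasing function of \<open>\<mu>\<close>. On the other hand \<open>G\<close> is strictly increasing when \<open>T1 < T_0\<close>
(\<open>G_strict_mono\<close>), which holds here because \<open>T1 < Tk\<close> and, the interface liquid being poorer than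
\<open>C_0\<close>, also \<open>Tk < T_0\<close>. Two such curves meet at most once (\<open>rubinstein_pair_unique\<close>).

The monotonicity of \<open>Q\<close> and of \<open>F\<^sub>1\<close> amounts to two classical bounds for \<open>erfc\<close>
(\<open>Mills_ratio_upper\<close>, \<open>Mills_ratio_lower\<close>).

That the explicit functions solve the free boundary problems is a computation. All four profiles
have the form \<open>p + q erf(x / (2 sqrt(a t)))\<close>, for which the heat equation and the limits
are established once. The two interface conditions are then \<open>Tk = F(\<lambda>)\<close> and \<open>M(\<lambda>) = \<phi>(Tk)\<close> in
disguise (\<open>heat_balance\<close>, \<open>solute_balance\<close>). The Rubinstein solution needs no separate
verification: for the same pair its temperature profile is the one of the similarity solution.
\<close>

section \<open>The error function\<close>

lemma erf_0 [simp]: "erf 0 = 0"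
  by (simp add: erf_def zero_ereal_def)

lemma erf_has_real_derivative:
  "(erf has_real_derivative 2 / sqrt pi * exp (- (x\<^sup>2))) (at x)"
proof -
  define b where "b = \<bar>x\<bar> + 1"
  have "((\<lambda>u. LBINT t=(0::real)..u. exp (- (t\<^sup>2)) :: real) has_vector_derivative exp (- (x\<^sup>2)))
          (at x within {-b..b})"
    by (rule interval_integral_FTC2) (auto simp: b_def intro!: continuous_intros)
  moreover have "at x within {-b..b} = at x"
    by (rule at_within_interior) (auto simp: b_def)
  ultimately have "((\<lambda>u. LBINT t=0..u. exp (- (t\<^sup>2)) :: real) has_real_derivative exp (- (x\<^sup>2))) (at x)"
    by (simp add: has_real_derivative_iff_has_vector_derivative zero_ereal_def)
  from DERIV_cmult[OF this, of "2 / sqrt pi"] show ?thesis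
    unfolding erf_def[abs_def] .
qed

lemma DERIV_erf_chain [derivative_intros]:
  assumes "(g has_real_derivative g') (at x within S)"
  shows "((\<lambda>x. erf (g x)) has_real_derivative 2 / sqrt pi * exp (- ((g x)\<^sup>2)) * g') (at x within S)"
  using DERIV_chain2[OF erf_has_real_derivative assms] .

lemma isCont_erf: "isCont erf x"
  using erf_has_real_derivative by (rule DERIV_isCont)

lemma tendsto_erf [tendsto_intros]:
  "(g \<longlongrightarrow> l) H \<Longrightarrow> ((\<lambda>x. erf (g x)) \<longlongrightarrow> erf l) H"
  by (rule isCont_tendsto_compose[OF isCont_erf])

lemma erf_strict_mono: "x < y \<Longrightarrow> erf x < erf y"
  by (rule DERIV_pos_imp_increasing[where f = erf]) (assumption, intro exI conjI, rule erf_has_real_derivative, simp)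

lemma erf_pos: "0 < x \<Longrightarrow> 0 < erf x"
  using erf_strict_mono[of 0 x] by simp

text \<open>The factor \<open>2 / sqrt \<pi>\<close> normalises the Gaussian integral over the half-line.\<close>

lemma erf_at_top: "(erf \<longlongrightarrow> 1) at_top"
proof -
  let ?f = "\<lambda>t::real. indicator {0..} t *\<^sub>R exp (- (t\<^sup>2)) :: real"
  have int: "integrable lborel ?f" and val: "(LINT t|lborel. ?f t) = sqrt pi / 2"
    using gaussian_moment_0 by (simp_all add: has_bochner_integral_iff)
  have "((\<lambda>y. LINT t|lborel. indicator {..y} t *\<^sub>R ?f t) \<longlongrightarrow> sqrt pi / 2) at_top"
    using tendsto_integral_at_top[OF _ int] unfolding val by simp
  then have "((\<lambda>y. 2 / sqrt pi * (LINT t|lborel. indicator {..y} t *\<^sub>R ?f t))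
      \<longlongrightarrow> 2 / sqrt pi * (sqrt pi / 2)) at_top"
    by (intro tendsto_intros)
  moreover have "\<forall>\<^sub>F y in at_top. 2 / sqrt pi * (LINT t|lborel. indicator {..y} t *\<^sub>R ?f t) = erf y"
    using eventually_ge_at_top[of 0]
  proof eventually_elim
    case (elim y)
    have "(LBINT t=(0::real)..y. exp (- (t\<^sup>2)) :: real) = (LBINT t:{0..y}. exp (- (t\<^sup>2)))"
      by (rule interval_integral_Icc) fact
    also have "\<dots> = (LINT t|lborel. indicator {..y} t *\<^sub>R ?f t)"
      unfolding set_lebesgue_integral_def
      by (rule Bochner_Integration.integral_cong) (auto simp: indicator_def)
    finally show ?case
      by (simp add: erf_def zero_ereal_def)
  qed
  ultimately show ?thesis
    by (auto dest: Lim_transform_eventually)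
qed

lemma erfc_has_real_derivative:
  "(erfc has_real_derivative - (2 / sqrt pi * exp (- (x\<^sup>2)))) (at x)"
  unfolding erfc_def[abs_def] by (auto intro!: derivative_eq_intros)

lemma DERIV_erfc_chain [derivative_intros]:
  assumes "(g has_real_derivative g') (at x within S)"
  shows "((\<lambda>x. erfc (g x)) has_real_derivative - (2 / sqrt pi * exp (- ((g x)\<^sup>2))) * g') (at x within S)"
  using DERIV_chain2[OF erfc_has_real_derivative assms] .

lemma erfc_at_top: "(erfc \<longlongrightarrow> 0) at_top"
  unfolding erfc_def[abs_def] using tendsto_diff[OF tendsto_const[of 1] erf_at_top] by simp

lemma erfc_pos: "0 < erfc x"
  by (rule DERIV_neg_imp_decreasing_at_top[OF _ erfc_at_top])
     (intro exI conjI, rule erfc_has_real_derivative, simp)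


section \<open>Monotonicity of the auxiliary functions\<close>

text \<open>The difference of the two sides is monotone and vanishes at infinity. This bound says exactly
  that \<open>Q < 1\<close>, and also that the derivative of \<open>F\<^sub>1\<close> is negative.\<close>

lemma Mills_ratio_upper:
  assumes "0 < x"
  shows "erfc x < exp (- (x\<^sup>2)) / (sqrt pi * x)"
proof -
  let ?h = "\<lambda>x. 1 / sqrt pi * (exp (- (x\<^sup>2)) / x) - erfc x"
  have lim: "(?h \<longlongrightarrow> 0) at_top"
  proof -
    have "((\<lambda>x. 1 / sqrt pi * (exp (- (x\<^sup>2)) / x)) \<longlongrightarrow> 0) at_top"
      by real_asymp
    from tendsto_diff[OF this erfc_at_top] show ?thesis by simp
  qed
  have "0 < ?h x"
  proof (rule DERIV_neg_imp_decreasing_at_top[OF _ lim])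
    fix y assume "x \<le> y"
    then have y: "0 < y" using assms by simp
    have "((\<lambda>x. exp (- (x\<^sup>2)) / x) has_real_derivative - (2 + 1 / y\<^sup>2) * exp (- (y\<^sup>2))) (at y)"
      using y by (auto intro!: derivative_eq_intros simp: field_simps power2_eq_square)
    from DERIV_diff[OF DERIV_cmult[OF this, of "1 / sqrt pi"] erfc_has_real_derivative[of y]]
    have "(?h has_real_derivative - (exp (- (y\<^sup>2)) / (sqrt pi * y\<^sup>2))) (at y)"
      by (rule DERIV_cong) (use y in \<open>simp add: field_simps\<close>)
    moreover have "- (exp (- (y\<^sup>2)) / (sqrt pi * y\<^sup>2)) < 0"
      using y by simp
    ultimately show "\<exists>d. (?h has_real_derivative d) (at y) \<and> d < 0" by blast
  qed
  then show ?thesis by (simp add: mult.commute)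
qed

text \<open>Same argument as for the upper bound. The rational factor is chosen so that the bound
  is equivalent to the positivity of the derivative of \<open>Q\<close>.\<close>

lemma Mills_ratio_lower:
  fixes x :: real
  shows "2 * x * exp (- (x\<^sup>2)) / (sqrt pi * (1 + 2 * x\<^sup>2)) < erfc x"
proof -
  let ?h = "\<lambda>x. erfc x - 2 / sqrt pi * (x * exp (- (x\<^sup>2)) / (1 + 2 * x\<^sup>2))"
  have lim: "(?h \<longlongrightarrow> 0) at_top"
  proof -
    have "((\<lambda>x. 2 / sqrt pi * (x * exp (- (x\<^sup>2)) / (1 + 2 * x\<^sup>2))) \<longlongrightarrow> 0) at_top"
      by real_asymp
    from tendsto_diff[OF erfc_at_top this] show ?thesis by simp
  qed
  have "0 < ?h x"
  proof (rule DERIV_neg_imp_decreasing_at_top[OF _ lim])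
    fix y :: real
    have p: "0 < 1 + 2 * y\<^sup>2" by (simp add: add_pos_nonneg)
    have "((\<lambda>x. x * exp (- (x\<^sup>2))) has_real_derivative (1 - 2 * y\<^sup>2) * exp (- (y\<^sup>2))) (at y)"
      by (auto intro!: derivative_eq_intros simp: algebra_simps power2_eq_square)
    moreover have "((\<lambda>x. 1 + 2 * x\<^sup>2) has_real_derivative 4 * y) (at y)"
      by (auto intro!: derivative_eq_intros)
    ultimately have "((\<lambda>x. x * exp (- (x\<^sup>2)) / (1 + 2 * x\<^sup>2)) has_real_derivative
        ((1 - 2 * y\<^sup>2) * exp (- (y\<^sup>2)) * (1 + 2 * y\<^sup>2) - y * exp (- (y\<^sup>2)) * (4 * y))
          / ((1 + 2 * y\<^sup>2) * (1 + 2 * y\<^sup>2))) (at y)"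
      by (rule DERIV_divide) (use p in simp)
    from DERIV_diff[OF erfc_has_real_derivative[of y] DERIV_cmult[OF this, of "2 / sqrt pi"]]
    have "(?h has_real_derivative - (4 * exp (- (y\<^sup>2)) / (sqrt pi * (1 + 2 * y\<^sup>2)\<^sup>2))) (at y)"
    proof (rule DERIV_cong)
      have "(1 - 2 * y\<^sup>2) * exp (- (y\<^sup>2)) * (1 + 2 * y\<^sup>2) - y * exp (- (y\<^sup>2)) * (4 * y)
          = exp (- (y\<^sup>2)) * (2 - (1 + 2 * y\<^sup>2) * (1 + 2 * y\<^sup>2))"
        by (simp add: algebra_simps power2_eq_square)
      then show "- (2 / sqrt pi * exp (- (y\<^sup>2))) - 2 / sqrt pi *
          (((1 - 2 * y\<^sup>2) * exp (- (y\<^sup>2)) * (1 + 2 * y\<^sup>2) - y * exp (- (y\<^sup>2)) * (4 * y))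
            / ((1 + 2 * y\<^sup>2) * (1 + 2 * y\<^sup>2)))
          = - (4 * exp (- (y\<^sup>2)) / (sqrt pi * (1 + 2 * y\<^sup>2)\<^sup>2))"
        using p by (simp add: right_diff_distrib diff_divide_distrib power2_eq_square[of "1 + 2 * y\<^sup>2"])
    qed
    moreover have "- (4 * exp (- (y\<^sup>2)) / (sqrt pi * (1 + 2 * y\<^sup>2)\<^sup>2)) < 0"
      using p by simp
    ultimately show "\<exists>d. (?h has_real_derivative d) (at y) \<and> d < 0" by blast
  qed
  then show ?thesis by (simp add: mult_ac)
qed

lemma Q_eq_F1: "Q x = sqrt pi * x * F\<^sub>1 x"
  by (simp add: Q_def F\<^sub>1_def)

lemma Q_pos: "0 < x \<Longrightarrow> 0 < Q x"
  by (simp add: Q_def erfc_pos)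

lemma Q_less_1:
  assumes "0 < x" shows "Q x < 1"
proof -
  have "erfc x * (sqrt pi * x * exp (x\<^sup>2)) < exp (- (x\<^sup>2)) / (sqrt pi * x) * (sqrt pi * x * exp (x\<^sup>2))"
    using Mills_ratio_upper[OF assms] assms by (intro mult_strict_right_mono) auto
  also have "\<dots> = 1"
    using assms by (simp add: exp_minus field_simps)
  finally show ?thesis
    by (simp add: Q_def mult_ac)
qed

lemma F1_has_real_derivative:
  "(F\<^sub>1 has_real_derivative 2 * x * F\<^sub>1 x - 2 / sqrt pi) (at x)"
  unfolding F\<^sub>1_def[abs_def]
  by (auto intro!: derivative_eq_intros simp: exp_minus field_simps)

lemma F1_strict_antimono:
  assumes "0 < x" "x < y" shows "F\<^sub>1 y < F\<^sub>1 x"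
proof (rule DERIV_neg_imp_decreasing[OF assms(2)])
  fix z assume "x \<le> z" "z \<le> y"
  then have z: "0 < z" using assms by simp
  have "2 * z * F\<^sub>1 z - 2 / sqrt pi < 0"
    using Q_less_1[OF z] by (simp add: Q_eq_F1 field_simps)
  then show "\<exists>d. (F\<^sub>1 has_real_derivative d) (at z) \<and> d < 0"
    using F1_has_real_derivative by blast
qed

lemma Q_strict_mono:
  assumes "x < y" shows "Q x < Q y"
proof (rule DERIV_pos_imp_increasing[OF assms])
  fix z :: real
  have p: "0 < 1 + 2 * z\<^sup>2" by (simp add: add_pos_nonneg)
  have "(Q has_real_derivative sqrt pi * (1 + 2 * z\<^sup>2) * F\<^sub>1 z - 2 * z) (at z)"
    unfolding Q_eq_F1[abs_def]
    by (auto intro!: derivative_eq_intros F1_has_real_derivative simp: field_simps power2_eq_square)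
  moreover have "0 < sqrt pi * (1 + 2 * z\<^sup>2) * F\<^sub>1 z - 2 * z"
  proof -
    have "2 * z * exp (- (z\<^sup>2)) / (sqrt pi * (1 + 2 * z\<^sup>2)) * (sqrt pi * (1 + 2 * z\<^sup>2) * exp (z\<^sup>2))
        < erfc z * (sqrt pi * (1 + 2 * z\<^sup>2) * exp (z\<^sup>2))"
      using Mills_ratio_lower[of z] p by (intro mult_strict_right_mono) auto
    moreover have "2 * z * exp (- (z\<^sup>2)) / (sqrt pi * (1 + 2 * z\<^sup>2)) * (sqrt pi * (1 + 2 * z\<^sup>2) * exp (z\<^sup>2)) = 2 * z"
      using p by (simp add: exp_minus divide_simps)
    ultimately show ?thesis
      by (simp add: F\<^sub>1_def mult_ac)
  qed
  ultimately show "\<exists>d. (Q has_real_derivative d) (at z) \<and> 0 < d" by blast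
qed

lemma Q1_pos: "0 < x \<Longrightarrow> 0 < Q\<^sub>1 x"
  by (simp add: Q\<^sub>1_def erf_pos)

text \<open>Removing the factor \<open>x\<close> from \<open>Q\<^sub>1\<close> keeps it increasing, whereas removing it from \<open>Q\<close> gives
  the decreasing function \<open>F\<^sub>1\<close>. This contrast determines the quotient \<open>Q(c x) / Q\<^sub>1(x)\<close> in \<open>G\<close>.\<close>

lemma Q1_over_x_strict_mono:
  assumes "0 < x" "x < y" shows "Q\<^sub>1 x / x < Q\<^sub>1 y / y"
proof -
  have "exp (x\<^sup>2) * erf x < exp (y\<^sup>2) * erf y"
    using assms erf_strict_mono[of x y] erf_pos[of x]
    by (intro mult_strict_mono) (auto simp: power2_eq_square intro!: mult_strict_mono)
  then show ?thesis using assms by (simp add: Q\<^sub>1_def)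
qed

lemma Q1_strict_mono:
  assumes "0 < x" "x < y" shows "Q\<^sub>1 x < Q\<^sub>1 y"
proof -
  have "x * (Q\<^sub>1 x / x) < y * (Q\<^sub>1 y / y)"
    using assms Q1_over_x_strict_mono[OF assms] Q1_pos[of x]
    by (intro mult_strict_mono) auto
  then show ?thesis using assms by simp
qed


section \<open>Self-similar solutions of the heat equation\<close>

text \<open>Up to the choice of \<open>p\<close> and \<open>q\<close> this covers the profiles with \<open>erfc\<close>
  and the constant one as well.\<close>

definition erf_profile :: "real \<Rightarrow> real \<Rightarrow> real \<Rightarrow> real \<Rightarrow> real \<Rightarrow> real" where
  "erf_profile p q a x t = p + q * erf (x / (2 * sqrt (a * t)))"

lemma erf_profile_DERIV_x:
  assumes "0 < a" "0 < t"
  shows "((\<lambda>x. erf_profile p q a x t) has_real_derivative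
      q / sqrt (pi * a * t) * exp (- ((x / (2 * sqrt (a * t)))\<^sup>2))) (at x)"
proof -
  have "((\<lambda>x. p + q * erf (x / (2 * sqrt (a * t)))) has_real_derivative
      0 + q * (2 / sqrt pi * exp (- ((x / (2 * sqrt (a * t)))\<^sup>2)) * (1 / (2 * sqrt (a * t))))) (at x)"
    by (intro DERIV_add DERIV_const DERIV_cmult DERIV_erf_chain DERIV_cdivide DERIV_ident)
  then show ?thesis
    unfolding erf_profile_def
    by (rule DERIV_cong) (simp add: real_sqrt_mult mult_ac)
qed

lemma dx_erf_profile:
  assumes "0 < a" "0 < t"
  shows "dx (erf_profile p q a) t =
    (\<lambda>x. q / sqrt (pi * a * t) * exp (- ((x / (2 * sqrt (a * t)))\<^sup>2)))"
  using DERIV_imp_deriv[OF erf_profile_DERIV_x[OF assms]] by blast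

lemma dx_erf_profile_tendsto:
  assumes "0 < a" "0 < t"
  shows "(dx (erf_profile p q a) t \<longlongrightarrow>
      q / sqrt (pi * a * t) * exp (- ((x / (2 * sqrt (a * t)))\<^sup>2))) (at x within S)"
  unfolding dx_erf_profile[OF assms] using assms by (intro tendsto_intros) auto

lemma erf_profile_tendsto:
  assumes "0 < a" "0 < t"
  shows "((\<lambda>x. erf_profile p q a x t) \<longlongrightarrow> p + q * erf (x / (2 * sqrt (a * t)))) (at x within S)"
  unfolding erf_profile_def using assms by (intro tendsto_intros) auto

text \<open>The far field and the initial value agree, since both limits send the similarity variable
  to infinity.\<close>

lemma erf_profile_far_field:
  assumes "0 < a" "0 < t"
  shows "((\<lambda>x. erf_profile p q a x t) \<longlongrightarrow> p + q) at_top"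
proof -
  have "filterlim (\<lambda>x. x / r) at_top at_top" if "0 < r" for r :: real
    using that by real_asymp
  from this[of "2 * sqrt (a * t)"]
  have "filterlim (\<lambda>x. x / (2 * sqrt (a * t))) at_top at_top"
    using assms by simp
  then have "((\<lambda>x. erf (x / (2 * sqrt (a * t)))) \<longlongrightarrow> 1) at_top"
    by (rule filterlim_compose[OF erf_at_top])
  then have "((\<lambda>x. p + q * erf (x / (2 * sqrt (a * t)))) \<longlongrightarrow> p + q * 1) at_top"
    by (intro tendsto_intros)
  then show ?thesis by (simp add: erf_profile_def)
qed

lemma erf_profile_initial:
  assumes "0 < a" "0 < x"
  shows "((\<lambda>t. erf_profile p q a x t) \<longlongrightarrow> p + q) (at_right 0)"
proof -
  have "filterlim (\<lambda>t. x / (2 * sqrt (a * t))) at_top (at_right 0)"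
    using assms by real_asymp
  then have "((\<lambda>t. erf (x / (2 * sqrt (a * t)))) \<longlongrightarrow> 1) (at_right 0)"
    by (rule filterlim_compose[OF erf_at_top])
  then have "((\<lambda>t. p + q * erf (x / (2 * sqrt (a * t)))) \<longlongrightarrow> p + q * 1) (at_right 0)"
    by (intro tendsto_intros)
  then show ?thesis by (simp add: erf_profile_def)
qed

text \<open>With \<open>r = sqrt(a t)\<close>, both sides of the heat equation come out as
  \<open>- a q x exp(-(x/2r)\<^sup>2) / (2 sqrt(\<pi>) r\<^sup>3)\<close>.\<close>

lemma heat_eq_at_erf_profile:
  assumes "0 < a" "0 < t"
  shows "heat_eq_at a (erf_profile p q a) x t"
proof -
  define r where "r = sqrt (a * t)"
  have r: "0 < r" "r\<^sup>2 = a * t" using assms by (auto simp: r_def)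
  let ?E = "exp (- ((x / (2 * r))\<^sup>2))"
  let ?v = "\<lambda>y. q / sqrt (pi * a * t) * exp (- ((y / (2 * r))\<^sup>2))"
  let ?w = "- (q * x / (2 * r ^ 3 * sqrt pi)) * ?E"
  have "\<forall>\<^sub>F y in nhds x. ((\<lambda>z. erf_profile p q a z t) has_real_derivative ?v y) (at y)"
    unfolding r_def using erf_profile_DERIV_x[OF assms] by (intro always_eventually) blast
  moreover have "(?v has_real_derivative ?w) (at x)"
  proof -
    have "((\<lambda>y. exp (- ((y / (2 * r))\<^sup>2))) has_real_derivative ?E * (- (x / (2 * r\<^sup>2)))) (at x)"
      using r by (auto intro!: derivative_eq_intros simp: power2_eq_square)
    from DERIV_cmult[OF this, of "q / sqrt (pi * a * t)"] show ?thesis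
    proof (rule DERIV_cong)
      have "sqrt (pi * a * t) = sqrt pi * r"
        by (simp add: r_def real_sqrt_mult)
      then show "q / sqrt (pi * a * t) * (?E * - (x / (2 * r\<^sup>2))) = ?w"
        by (simp add: power2_eq_square power3_eq_cube mult_ac)
    qed
  qed
  moreover have "((\<lambda>\<tau>. erf_profile p q a x \<tau>) has_real_derivative a * ?w) (at t)"
  proof -
    have "((\<lambda>\<tau>. sqrt (a * \<tau>)) has_real_derivative a / (2 * r)) (at t)"
      using assms by (auto intro!: derivative_eq_intros simp: r_def field_simps mult_less_0_iff)
    then have "((\<lambda>\<tau>. x / (2 * sqrt (a * \<tau>))) has_real_derivative
        (0 * (2 * sqrt (a * t)) - x * (2 * (a / (2 * r)))) / ((2 * sqrt (a * t)) * (2 * sqrt (a * t)))) (at t)"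
      by (intro DERIV_divide DERIV_cmult DERIV_const) (use r in \<open>auto simp: r_def\<close>)
    then have "((\<lambda>\<tau>. x / (2 * sqrt (a * \<tau>))) has_real_derivative - (a * x / (4 * r ^ 3))) (at t)"
      by (rule DERIV_cong)
         (use r in \<open>simp add: r_def[symmetric] power3_eq_cube field_simps\<close>)
    then have "((\<lambda>\<tau>. erf_profile p q a x \<tau>) has_real_derivative
        0 + q * (2 / sqrt pi * ?E * - (a * x / (4 * r ^ 3)))) (at t)"
      unfolding erf_profile_def r_def
      by (intro DERIV_add DERIV_const DERIV_cmult DERIV_erf_chain)
    then show ?thesis by (rule DERIV_cong) (simp add: field_simps)
  qed
  ultimately show ?thesis
    unfolding heat_eq_at_def by (intro exI[of _ ?v] exI[of _ ?w] conjI)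
qed


section \<open>Phase equilibrium\<close>

lemma M_gt_1:
  assumes "alloy_data A" "0 < x" shows "1 < M A x"
proof -
  have "0 < sqrt (alpha_s A / d_l A) * x" using assms by (simp add: alloy_data_def)
  then show ?thesis
    unfolding M_def using Q_pos Q_less_1 by (intro one_less_inverse) auto
qed

lemma M_strict_antimono:
  assumes "alloy_data A" "0 < x" "x < y" shows "M A y < M A x"
proof -
  let ?k = "sqrt (alpha_s A / d_l A)"
  have k: "0 < ?k" using assms by (simp add: alloy_data_def)
  have "Q (?k * x) < Q (?k * y)" "0 < Q (?k * x)"
    using k assms by (auto intro!: Q_strict_mono Q_pos)
  then show ?thesis unfolding M_def by (intro less_imp_inverse_less)
qed

text \<open>Since \<open>M > 1\<close>, the equation \<open>M = \<phi>\<close> selects the temperatures at which the initial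
  concentration lies strictly between liquidus and solidus. Above the liquidus temperature of \<open>C_0\<close>
  the quotient \<open>\<phi>\<close> is negative, and below the solidus temperature it is at most 1. As the alloy is
  initially liquid, such a temperature is below the initial one.\<close>

lemma phi_gt_1_imp_two_phase:
  assumes A: "alloy_data A" and T: "T_A A < T" "T < T_B A" and gt: "1 < \<phi> A T"
  shows "f_l A T < C_0 A" "C_0 A < f_s A T" "T < T_0 A"
proof -
  have ls: "f_l A T < f_s A T" using A T by (auto simp: alloy_data_def)
  show l: "f_l A T < C_0 A"
  proof (rule ccontr)
    assume "\<not> f_l A T < C_0 A"
    then have "\<phi> A T \<le> 0"
      unfolding \<phi>_def using ls by (intro divide_nonneg_nonpos) auto
    with gt show False by simp
  qed
  show "C_0 A < f_s A T" using gt l unfolding \<phi>_def by (simp add: field_simps)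
  have mono: "strict_mono_on {T_A A..T_B A} (f_l A)"
    and T0: "T_A A < T_0 A" "T_0 A < T_B A" "C_0 A < f_l A (T_0 A)"
    using A by (auto simp: alloy_data_def)
  have "f_l A T < f_l A (T_0 A)" using l T0 by simp
  then show "T < T_0 A"
    using strict_mono_on_less[OF mono, of T "T_0 A"] T T0 by simp
qed

text \<open>Here \<open>\<phi> = 1 + (f_s - C_0) / (C_0 - f_l)\<close>, where the numerator is positive and increases and the
  denominator is positive and decreases.\<close>

lemma phi_strict_mono:
  assumes A: "alloy_data A" and T: "T_A A < T" "T < U" "U < T_B A"
    and gt: "1 < \<phi> A T" "1 < \<phi> A U"
  shows "\<phi> A T < \<phi> A U"
proof -
  note T' = phi_gt_1_imp_two_phase[OF A _ _ gt(1)] and U' = phi_gt_1_imp_two_phase[OF A _ _ gt(2)]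
  have t: "f_l A T < C_0 A" "C_0 A < f_s A T" using T' T by auto
  have u: "f_l A U < C_0 A" "C_0 A < f_s A U" using U' T by auto
  have mono: "f_l A T < f_l A U" "f_s A T < f_s A U"
    using A T by (auto simp: alloy_data_def intro: strict_mono_onD)
  have eq: "\<phi> A X = 1 + (f_s A X - C_0 A) / (C_0 A - f_l A X)" if "f_l A X < C_0 A" for X
    using that by (simp add: \<phi>_def field_simps)
  have "(f_s A T - C_0 A) / (C_0 A - f_l A T) < (f_s A U - C_0 A) / (C_0 A - f_l A U)"
    using t u mono by (intro frac_less2) auto
  then show ?thesis using eq t u by simp
qed

text \<open>With \<open>a = k_s \<alpha>_l Q(c x)\<close> and \<open>b = k_l \<alpha>_s Q\<^sub>1(x)\<close>, the function \<open>G\<close> is the weighted mean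
  \<open>(a T1 + b T_0) / (a + b)\<close> plus a multiple of \<open>a b / (a + b)\<close>. The second term grows
  because \<open>a\<close> and \<open>b\<close> do; the mean moves from \<open>T1\<close> towards the larger \<open>T_0\<close> because \<open>a / b\<close> decreases.\<close>

lemma G_strict_mono:
  assumes A: "alloy_data A" and T1: "T1 < T_0 A" and xy: "0 < x" "x < y"
  shows "G A T1 x < G A T1 y"
proof -
  have pos: "0 < alpha_s A" "0 < alpha_l A" "0 < k_s A" "0 < k_l A" "0 < rho A" "0 < gam A"
    using A by (auto simp: alloy_data_def)
  have c: "0 < c A" using pos by (simp add: c_def)
  define a where "a z = k_s A * alpha_l A * Q (c A * z)" for z
  define b where "b z = k_l A * alpha_s A * Q\<^sub>1 z" for z
  define K where "K = gam A * rho A / (k_s A * k_l A)"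
  have K: "0 < K" using pos by (simp add: K_def)
  have abpos: "0 < a z" "0 < b z" if "0 < z" for z
    using that pos c by (auto simp: a_def b_def Q_pos Q1_pos)
  have G_eq: "G A T1 z = T1 + (T_0 A - T1) * inverse (1 + a z / b z) + K * inverse (inverse (a z) + inverse (b z))"
    if z: "0 < z" for z
  proof -
    have "G A T1 z = (K * a z * b z + T1 * a z + T_0 A * b z) / (a z + b z)"
      using pos by (simp add: G_def a_def b_def K_def mult_ac)
    also have "\<dots> = T1 + (T_0 A - T1) * inverse (1 + a z / b z) + K * inverse (inverse (a z) + inverse (b z))"
    proof -
      have "inverse (1 + a z / b z) = b z / (a z + b z)"
        "inverse (inverse (a z) + inverse (b z)) = a z * b z / (a z + b z)"
        using abpos[OF z] by (simp_all add: field_simps)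
      moreover have "a z + b z \<noteq> 0" using abpos[OF z] by simp
      then have "(K * a z * b z + T1 * a z + T_0 A * b z) / (a z + b z)
          = T1 + (T_0 A - T1) * (b z / (a z + b z)) + K * (a z * b z / (a z + b z))"
      proof -
        have "K * a z * b z + T1 * a z + T_0 A * b z
            = T1 * (a z + b z) + (T_0 A - T1) * b z + K * (a z * b z)"
          by (simp add: algebra_simps)
        then show ?thesis
          by (simp only: add_divide_distrib times_divide_eq_right
              nonzero_mult_div_cancel_right[OF \<open>a z + b z \<noteq> 0\<close>])
      qed
      ultimately show ?thesis by metis
    qed
    finally show ?thesis .
  qed
  have y: "0 < y" using xy by simp
  have ab: "a x < a y" "b x < b y"
    using pos c xy by (auto simp: a_def b_def intro!: mult_strict_left_mono Q_strict_mono Q1_strict_mono)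
  have "a y / b y < a x / b x"
  proof -
    \<comment> \<open>Cancelling \<open>z\<close> leaves a decreasing numerator over an increasing denominator.\<close>
    have ratio: "a z / b z = k_s A * alpha_l A * sqrt pi * c A / (k_l A * alpha_s A) * (F\<^sub>1 (c A * z) / (Q\<^sub>1 z / z))"
      if "0 < z" for z
      using that pos Q1_pos[OF that] by (simp add: a_def b_def Q_eq_F1 field_simps)
    have "F\<^sub>1 (c A * y) / (Q\<^sub>1 y / y) < F\<^sub>1 (c A * x) / (Q\<^sub>1 x / x)"
    proof (rule frac_less)
      show "0 \<le> F\<^sub>1 (c A * y)" by (simp add: F\<^sub>1_def erfc_pos less_imp_le)
      show "F\<^sub>1 (c A * y) < F\<^sub>1 (c A * x)" using xy c by (intro F1_strict_antimono) auto
      show "0 < Q\<^sub>1 x / x" using Q1_pos xy by simp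
      show "Q\<^sub>1 x / x \<le> Q\<^sub>1 y / y" using Q1_over_x_strict_mono[OF xy] by simp
    qed
    then show ?thesis
      unfolding ratio[OF xy(1)] ratio[OF y] using pos c by (intro mult_strict_left_mono) auto
  qed
  then have "inverse (1 + a x / b x) < inverse (1 + a y / b y)"
    using abpos[OF y] by (intro less_imp_inverse_less) (auto intro: add_pos_pos)
  moreover have "inverse (inverse (a x) + inverse (b x)) < inverse (inverse (a y) + inverse (b y))"
    using ab abpos[OF xy(1)] abpos[OF y]
    by (intro less_imp_inverse_less add_strict_mono add_pos_pos) auto
  ultimately show ?thesis
    unfolding G_eq[OF xy(1)] G_eq[OF y] using T1 K
    by (intro add_strict_mono add_strict_left_mono mult_strict_left_mono) auto
qed

text \<open>A larger \<open>\<mu>\<close> would give a larger temperature through \<open>G\<close> but a smaller one through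
  \<open>M(\<mu>) = \<phi>(T)\<close>.\<close>

lemma rubinstein_pair_unique:
  assumes A: "alloy_data A" and T1: "T1 < T_0 A"
    and p1: "rubinstein_pair A T1 mu T" and p2: "rubinstein_pair A T1 nu U"
  shows "mu = nu \<and> T = U"
proof -
  have less: False
    if p: "rubinstein_pair A T1 mu T" "rubinstein_pair A T1 nu U" and lt: "mu < nu" for mu nu T U
  proof -
    from p have mu: "0 < mu" "0 < nu" and T: "T_A A < T" "U < T_B A"
      and G: "T = G A T1 mu" "U = G A T1 nu" and M: "M A mu = \<phi> A T" "M A nu = \<phi> A U"
      by (auto simp: rubinstein_pair_def)
    have TU: "T < U" using G_strict_mono[OF A T1 mu(1) lt] G by simp
    have "\<phi> A T < \<phi> A U"
      using phi_strict_mono[OF A T(1) TU T(2)] M_gt_1[OF A mu(1)] M_gt_1[OF A mu(2)] M by simp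
    moreover have "\<phi> A U < \<phi> A T"
      using M_strict_antimono[OF A mu(1) lt] M by simp
    ultimately show False by simp
  qed
  have "mu = nu" using less[OF p1 p2] less[OF p2 p1] by (meson linorder_neqE_linordered_idom)
  then show ?thesis using p1 p2 by (auto simp: rubinstein_pair_def)
qed


section \<open>The explicit solutions\<close>

lemma similarity_Ts_eq:
  "similarity_Ts A q0 lam Tk =
    erf_profile (Tk - q0 / k_s A * sqrt (pi * alpha_s A) * erf lam)
      (q0 / k_s A * sqrt (pi * alpha_s A)) (alpha_s A)"
  by (intro ext) (simp add: similarity_Ts_def erf_profile_def)

lemma erf_profile_erfc:
  "p + r * erfc (x / (2 * sqrt (a * t))) = erf_profile (p + r) (- r) a x t"
  by (simp add: erf_profile_def erfc_def algebra_simps)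

lemma profile_Tl_eq:
  "profile_Tl A lam Tk =
    erf_profile (T_0 A + (Tk - T_0 A) / erfc (c A * lam)) (- ((Tk - T_0 A) / erfc (c A * lam))) (alpha_l A)"
  by (intro ext) (simp only: profile_Tl_def erf_profile_erfc)

lemma profile_Cs_eq: "profile_Cs A Tk = erf_profile (f_s A Tk) 0 (d_s A)"
  by (intro ext) (simp add: profile_Cs_def erf_profile_def)

lemma profile_Cl_eq:
  "profile_Cl A lam Tk =
    erf_profile (C_0 A + (f_l A Tk - C_0 A) / erfc (sqrt (alpha_s A / d_l A) * lam))
      (- ((f_l A Tk - C_0 A) / erfc (sqrt (alpha_s A / d_l A) * lam))) (d_l A)"
  by (intro ext) (simp only: profile_Cl_def erf_profile_erfc)

text \<open>Along the front the similarity variable of every diffusivity is constant in time,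
  which is why the interface conditions reduce to equations between numbers.\<close>

lemma front_rescaled:
  assumes "0 < alpha_s A" "0 < a" "0 < t"
  shows "front A lam t / (2 * sqrt (a * t)) = sqrt (alpha_s A / a) * lam"
  using assms by (simp add: front_def real_sqrt_mult real_sqrt_divide)

text \<open>The energy condition on the front, multiplied by \<open>sqrt t\<close>. The flux into the solid contributes
  the term with \<open>q0\<close>, the flux from the liquid the second one, and the latent heat the right-hand side.\<close>

lemma heat_balance:
  assumes A: "alloy_data A" and lam: "0 < lam" and Tk: "Tk = F A q0 lam"
  shows "q0 * exp (- (lam\<^sup>2)) + k_l A * ((Tk - T_0 A) / erfc (c A * lam)) * exp (- ((c A * lam)\<^sup>2)) / sqrt (pi * alpha_l A)
    = gam A * rho A * lam * sqrt (alpha_s A)"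
proof -
  have pos: "0 < alpha_s A" "0 < alpha_l A" "0 < k_l A"
    using A by (auto simp: alloy_data_def)
  define z where "z = c A * lam"
  have "alpha_l A * Q z = sqrt (pi * alpha_l A) * (lam * sqrt (alpha_s A)) * F\<^sub>1 z"
  proof -
    have "alpha_l A * c A = sqrt (alpha_l A) * sqrt (alpha_s A)"
      using pos by (simp add: c_def real_sqrt_divide field_simps)
    then show ?thesis
      by (simp add: Q_eq_F1 z_def real_sqrt_mult mult_ac)
  qed
  moreover have "Tk - T_0 A = (gam A * rho A * (alpha_l A * Q z)
      - q0 * sqrt (pi * alpha_l A) * exp (- (lam\<^sup>2)) * F\<^sub>1 z) / k_l A"
    using pos by (simp add: Tk F_def z_def mult_ac diff_divide_distrib)
  ultimately have "Tk - T_0 A = (gam A * rho A * lam * sqrt (alpha_s A) - q0 * exp (- (lam\<^sup>2)))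
      * (sqrt (pi * alpha_l A) / k_l A * F\<^sub>1 z)"
    using pos by (simp add: field_simps)
  then have "(Tk - T_0 A) / erfc z = (gam A * rho A * lam * sqrt (alpha_s A) - q0 * exp (- (lam\<^sup>2)))
      * (sqrt (pi * alpha_l A) / k_l A * exp (z\<^sup>2))"
    using erfc_pos[of z] by (simp add: F\<^sub>1_def)
  then have "k_l A * ((Tk - T_0 A) / erfc z) * exp (- (z\<^sup>2)) / sqrt (pi * alpha_l A)
      = gam A * rho A * lam * sqrt (alpha_s A) - q0 * exp (- (lam\<^sup>2))"
    using pos by (simp add: exp_minus)
  then show ?thesis by (simp add: z_def)
qed

text \<open>The solute condition on the front, multiplied by \<open>sqrt t\<close>. There is no term for the solid,
  where the concentration is constant.\<close>

lemma solute_balance: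
  assumes A: "alloy_data A" and lam: "0 < lam" and eq: "M A lam = \<phi> A Tk" and l: "f_l A Tk < C_0 A"
  defines "z \<equiv> sqrt (alpha_s A / d_l A) * lam"
  shows "d_l A * ((C_0 A - f_l A Tk) / erfc z) * exp (- (z\<^sup>2)) / sqrt (pi * d_l A)
    = (f_s A Tk - f_l A Tk) * (lam * sqrt (alpha_s A))"
proof -
  have pos: "0 < alpha_s A" "0 < d_l A" using A by (auto simp: alloy_data_def)
  have z: "0 < z" using pos lam by (simp add: z_def)
  have "inverse (Q z) = (f_s A Tk - f_l A Tk) / (C_0 A - f_l A Tk)"
    using eq by (simp add: M_def \<phi>_def z_def)
  then have "f_s A Tk - f_l A Tk = (C_0 A - f_l A Tk) / Q z"
    using l by (simp add: field_simps)
  then have "(f_s A Tk - f_l A Tk) * (lam * sqrt (alpha_s A))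
      = (C_0 A - f_l A Tk) / erfc z * exp (- (z\<^sup>2)) / sqrt pi * (lam * sqrt (alpha_s A) / z)"
    by (simp add: Q_def exp_minus field_simps)
  also have "lam * sqrt (alpha_s A) / z = sqrt (d_l A)"
    using pos lam by (simp add: z_def real_sqrt_divide)
  also have "(C_0 A - f_l A Tk) / erfc z * exp (- (z\<^sup>2)) / sqrt pi * sqrt (d_l A)
      = d_l A * ((C_0 A - f_l A Tk) / erfc z) * exp (- (z\<^sup>2)) / sqrt (pi * d_l A)"
  proof -
    have "sqrt (d_l A) / sqrt pi = d_l A / sqrt (pi * d_l A)"
      using pos by (simp add: real_sqrt_mult field_simps)
    then have "(C_0 A - f_l A Tk) / erfc z * exp (- (z\<^sup>2)) * (sqrt (d_l A) / sqrt pi)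
        = (C_0 A - f_l A Tk) / erfc z * exp (- (z\<^sup>2)) * (d_l A / sqrt (pi * d_l A))"
      by (rule arg_cong)
    then show ?thesis by (simp add: mult_ac)
  qed
  finally show ?thesis by simp
qed

lemma similarity_pairD:
  assumes A: "alloy_data A" and p: "similarity_pair A q0 lam Tk"
  shows "0 < lam" "T_A A < Tk" "Tk < T_B A" "Tk = F A q0 lam" "M A lam = \<phi> A Tk"
    "f_l A Tk < C_0 A" "Tk < T_0 A"
proof -
  show *: "0 < lam" "T_A A < Tk" "Tk < T_B A" "Tk = F A q0 lam" "M A lam = \<phi> A Tk"
    using p by (auto simp: similarity_pair_def)
  have "1 < \<phi> A Tk" using M_gt_1[OF A *(1)] *(5) by simp
  then show "f_l A Tk < C_0 A" "Tk < T_0 A"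
    using phi_gt_1_imp_two_phase[OF A *(2,3)] by auto
qed

lemma similarity_solidification:
  assumes A: "alloy_data A" and p: "similarity_pair A q0 lam Tk"
  shows "solidification A (front A lam) Tk
    (similarity_Ts A q0 lam Tk) (profile_Tl A lam Tk) (profile_Cs A Tk) (profile_Cl A lam Tk)"
proof -
  note D = similarity_pairD[OF A p]
  have pos: "0 < alpha_s A" "0 < alpha_l A" "0 < d_s A" "0 < d_l A" "0 < k_s A" "0 < k_l A"
    using A by (auto simp: alloy_data_def)
  let ?s = "front A lam" and ?k = "sqrt (alpha_s A / d_l A)"
  have s_pos: "0 < ?s t" if "0 < t" for t
    using that D(1) pos by (simp add: front_def)
  have s_0: "(?s \<longlongrightarrow> 0) (at_right 0)"
  proof -
    have "((\<lambda>t. 2 * lam * sqrt (alpha_s A * t)) \<longlongrightarrow> 2 * lam * sqrt (alpha_s A * 0)) (at_right 0)"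
      by (intro tendsto_intros)
    then show ?thesis by (simp add: front_def[abs_def])
  qed
  have s_s: "?s t / (2 * sqrt (alpha_s A * t)) = lam"
    and s_l: "?s t / (2 * sqrt (alpha_l A * t)) = c A * lam"
    and s_d: "?s t / (2 * sqrt (d_l A * t)) = ?k * lam" if "0 < t" for t
    using front_rescaled[of A _ t lam] that pos by (auto simp: c_def)
  have heat: "heat_eq_at (alpha_s A) (similarity_Ts A q0 lam Tk) x t"
      "heat_eq_at (alpha_l A) (profile_Tl A lam Tk) x t"
      "heat_eq_at (d_s A) (profile_Cs A Tk) x t"
      "heat_eq_at (d_l A) (profile_Cl A lam Tk) x t" if "0 < t" for x t
    unfolding similarity_Ts_eq profile_Tl_eq profile_Cs_eq profile_Cl_eq
    using that pos by (auto intro!: heat_eq_at_erf_profile)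
  have init: "((\<lambda>t. profile_Tl A lam Tk x t) \<longlongrightarrow> T_0 A) (at_right 0)"
      "((\<lambda>t. profile_Cl A lam Tk x t) \<longlongrightarrow> C_0 A) (at_right 0)" if "0 < x" for x
  proof -
    show "((\<lambda>t. profile_Tl A lam Tk x t) \<longlongrightarrow> T_0 A) (at_right 0)"
      unfolding profile_Tl_eq by (rule tendsto_eq_rhs[OF erf_profile_initial]) (use that pos in auto)
    show "((\<lambda>t. profile_Cl A lam Tk x t) \<longlongrightarrow> C_0 A) (at_right 0)"
      unfolding profile_Cl_eq by (rule tendsto_eq_rhs[OF erf_profile_initial]) (use that pos in auto)
  qed
  have far: "((\<lambda>x. profile_Tl A lam Tk x t) \<longlongrightarrow> T_0 A) at_top" if "0 < t" for t
    unfolding profile_Tl_eq by (rule tendsto_eq_rhs[OF erf_profile_far_field]) (use that pos in auto)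
  have boundary: "((\<lambda>x. similarity_Ts A q0 lam Tk x t) \<longlongrightarrow> Tk) (at_left (?s t))"
      "((\<lambda>x. profile_Tl A lam Tk x t) \<longlongrightarrow> Tk) (at_right (?s t))"
      "((\<lambda>x. profile_Cs A Tk x t) \<longlongrightarrow> f_s A Tk) (at_left (?s t))"
      "((\<lambda>x. profile_Cl A lam Tk x t) \<longlongrightarrow> f_l A Tk) (at_right (?s t))" if t: "0 < t" for t
  proof -
    \<comment> \<open>On the front the factor \<open>erfc\<close> of the liquid profiles cancels their denominator.\<close>
    have cancel: "p + r / erfc z + - (r / erfc z) * erf z = p + r" for p r z
    proof -
      have "erf z = 1 - erfc z" by (simp add: erfc_def)
      then show ?thesis using erfc_pos[of z] by (simp add: right_diff_distrib)
    qed
    show "((\<lambda>x. similarity_Ts A q0 lam Tk x t) \<longlongrightarrow> Tk) (at_left (?s t))"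
      unfolding similarity_Ts_eq
      by (rule tendsto_eq_rhs[OF erf_profile_tendsto]) (use t pos s_s in auto)
    show "((\<lambda>x. profile_Tl A lam Tk x t) \<longlongrightarrow> Tk) (at_right (?s t))"
      unfolding profile_Tl_eq
      by (rule tendsto_eq_rhs[OF erf_profile_tendsto[OF pos(2) t]]) (simp only: s_l[OF t] cancel)
    show "((\<lambda>x. profile_Cs A Tk x t) \<longlongrightarrow> f_s A Tk) (at_left (?s t))"
      by (simp add: profile_Cs_def)
    show "((\<lambda>x. profile_Cl A lam Tk x t) \<longlongrightarrow> f_l A Tk) (at_right (?s t))"
      unfolding profile_Cl_eq
      by (rule tendsto_eq_rhs[OF erf_profile_tendsto[OF pos(4) t]]) (simp only: s_d[OF t] cancel)
  qed
  have Cs_flux: "(dx (profile_Cs A Tk) t \<longlongrightarrow> 0) (at x within S)" for t x S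
    by (simp add: profile_Cs_def)
  have stefan: "\<exists>s' Tsx Tlx Csx Clx.
           (?s has_real_derivative s') (at t) \<and>
           (dx (similarity_Ts A q0 lam Tk) t \<longlongrightarrow> Tsx) (at_left (?s t)) \<and>
           (dx (profile_Tl A lam Tk) t \<longlongrightarrow> Tlx) (at_right (?s t)) \<and>
           (dx (profile_Cs A Tk) t \<longlongrightarrow> Csx) (at_left (?s t)) \<and>
           (dx (profile_Cl A lam Tk) t \<longlongrightarrow> Clx) (at_right (?s t)) \<and>
           k_s A * Tsx - k_l A * Tlx = gam A * rho A * s' \<and>
           d_l A * Clx - d_s A * Csx = (f_s A Tk - f_l A Tk) * s'" if t: "0 < t" for t
  proof -
    let ?Tsx = "q0 / k_s A * sqrt (pi * alpha_s A) / sqrt (pi * alpha_s A * t) * exp (- (lam\<^sup>2))"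
    let ?Tlx = "- ((Tk - T_0 A) / erfc (c A * lam)) / sqrt (pi * alpha_l A * t) * exp (- ((c A * lam)\<^sup>2))"
    let ?Clx = "- ((f_l A Tk - C_0 A) / erfc (?k * lam)) / sqrt (pi * d_l A * t) * exp (- ((?k * lam)\<^sup>2))"
    let ?s' = "lam * sqrt (alpha_s A) / sqrt t"
    have "((\<lambda>t. sqrt (alpha_s A * t)) has_real_derivative sqrt (alpha_s A) / (2 * sqrt t)) (at t)"
      using t pos by (auto intro!: derivative_eq_intros simp: real_sqrt_mult field_simps)
    from DERIV_cmult[OF this, of "2 * lam"]
    have "(?s has_real_derivative ?s') (at t)"
      unfolding front_def[abs_def] by simp
    moreover have "(dx (similarity_Ts A q0 lam Tk) t \<longlongrightarrow> ?Tsx) (at_left (?s t))"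
      unfolding similarity_Ts_eq
      by (rule tendsto_eq_rhs[OF dx_erf_profile_tendsto]) (use t pos s_s in auto)
    moreover have "(dx (profile_Tl A lam Tk) t \<longlongrightarrow> ?Tlx) (at_right (?s t))"
      unfolding profile_Tl_eq
      by (rule tendsto_eq_rhs[OF dx_erf_profile_tendsto[OF pos(2) t]]) (simp only: s_l[OF t])
    moreover have "(dx (profile_Cl A lam Tk) t \<longlongrightarrow> ?Clx) (at_right (?s t))"
      unfolding profile_Cl_eq
      by (rule tendsto_eq_rhs[OF dx_erf_profile_tendsto[OF pos(4) t]]) (simp only: s_d[OF t])
    moreover have "k_s A * ?Tsx - k_l A * ?Tlx = gam A * rho A * ?s'"
    proof -
      have "k_s A * ?Tsx - k_l A * ?Tlx = (q0 * exp (- (lam\<^sup>2))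
          + k_l A * ((Tk - T_0 A) / erfc (c A * lam)) * exp (- ((c A * lam)\<^sup>2)) / sqrt (pi * alpha_l A)) / sqrt t"
        using pos by (simp add: real_sqrt_mult add_divide_distrib)
      then show ?thesis unfolding heat_balance[OF A D(1,4)] by simp
    qed
    moreover have "d_l A * ?Clx - d_s A * 0 = (f_s A Tk - f_l A Tk) * ?s'"
    proof -
      have "- ((f_l A Tk - C_0 A) / erfc (?k * lam)) = (C_0 A - f_l A Tk) / erfc (?k * lam)"
        by (simp add: minus_divide_left)
      then have "d_l A * ?Clx - d_s A * 0 = (d_l A * ((C_0 A - f_l A Tk) / erfc (?k * lam))
          * exp (- ((?k * lam)\<^sup>2)) / sqrt (pi * d_l A)) / sqrt t"
        by (simp add: real_sqrt_mult)
      then show ?thesis unfolding solute_balance[OF A D(1,5,6)] by simp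
    qed
    ultimately show ?thesis using Cs_flux by blast
  qed
  show ?thesis
    unfolding solidification_def
    using D(2,3) s_pos s_0 heat init far boundary Cs_flux stefan
    by (smt (verit, best))
qed

lemma similarity_Ts_flux:
  assumes A: "alloy_data A" and t: "0 < t"
  shows "((\<lambda>x. k_s A * dx (similarity_Ts A q0 lam Tk) t x) \<longlongrightarrow> q0 / sqrt t) (at_right 0)"
proof -
  have pos: "0 < alpha_s A" "0 < k_s A" using A by (auto simp: alloy_data_def)
  have "((\<lambda>x. k_s A * dx (similarity_Ts A q0 lam Tk) t x) \<longlongrightarrow>
      k_s A * (q0 / k_s A * sqrt (pi * alpha_s A) / sqrt (pi * alpha_s A * t)
        * exp (- ((0 / (2 * sqrt (alpha_s A * t)))\<^sup>2)))) (at_right 0)"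
    unfolding similarity_Ts_eq
    by (intro tendsto_mult tendsto_const dx_erf_profile_tendsto pos t)
  then show ?thesis using pos by (simp add: real_sqrt_mult)
qed

text \<open>After clearing the denominator of \<open>G\<close>, the contribution of the surface flux \<open>q0\<close> appears once through
  \<open>Tk - T1\<close> and once through \<open>Tk - T_0 = F(\<lambda>) - T_0\<close>, with opposite signs. The two cancel because
  \<open>\<alpha>_l sqrt(\<alpha>_s) c = \<alpha>_s sqrt(\<alpha>_l)\<close>.\<close>

lemma similarity_imp_rubinstein_pair:
  assumes A: "alloy_data A" and p: "similarity_pair A q0 lam Tk"
    and T1: "T1 = Tk - q0 / k_s A * sqrt (alpha_s A * pi) * erf lam"
  shows "rubinstein_pair A T1 lam Tk"
proof -
  note D = similarity_pairD[OF A p]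
  have pos: "0 < alpha_s A" "0 < alpha_l A" "0 < k_s A" "0 < k_l A"
    using A by (auto simp: alloy_data_def)
  have cpos: "0 < c A" using pos by (simp add: c_def)
  let ?q = "Q (c A * lam)" and ?q1 = "Q\<^sub>1 lam"
  have den: "0 < k_s A * alpha_l A * ?q + k_l A * alpha_s A * ?q1"
    using pos cpos D(1) by (intro add_pos_pos mult_pos_pos Q_pos Q1_pos) auto
  have "(Tk - T1) * (k_s A * alpha_l A * ?q) + (Tk - T_0 A) * (k_l A * alpha_s A * ?q1)
      = gam A * rho A * alpha_s A * alpha_l A * ?q1 * ?q"
  proof -
    have "alpha_l A * sqrt (alpha_s A) * c A = alpha_s A * sqrt (alpha_l A)"
    proof -
      have "sqrt (alpha_s A) * sqrt (alpha_s A) = alpha_s A" "sqrt (alpha_l A) * sqrt (alpha_l A) = alpha_l A"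
        using pos by auto
      then show ?thesis using pos by (simp add: c_def real_sqrt_divide field_simps)
    qed
    then have "(alpha_l A * sqrt (alpha_s A) * c A) * (q0 * pi * lam * erf lam * F\<^sub>1 (c A * lam))
        = (alpha_s A * sqrt (alpha_l A)) * (q0 * pi * lam * erf lam * F\<^sub>1 (c A * lam))"
      by simp
    moreover have "(Tk - T1) * (k_s A * alpha_l A * ?q)
        = (alpha_l A * sqrt (alpha_s A) * c A) * (q0 * pi * lam * erf lam * F\<^sub>1 (c A * lam))"
      using pos by (simp add: T1 Q_eq_F1 real_sqrt_mult mult_ac)
    moreover have "(Tk - T_0 A) * (k_l A * alpha_s A * ?q1) = gam A * rho A * alpha_s A * alpha_l A * ?q1 * ?q
        - (alpha_s A * sqrt (alpha_l A)) * (q0 * pi * lam * erf lam * F\<^sub>1 (c A * lam))"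
    proof -
      have "exp (- (lam\<^sup>2)) * ?q1 = sqrt pi * lam * erf lam"
        by (simp add: Q\<^sub>1_def exp_minus)
      then have e: "q0 * (sqrt (alpha_l A) * sqrt pi) * (exp (- (lam\<^sup>2)) * ?q1) * F\<^sub>1 (c A * lam) * alpha_s A
          = (alpha_s A * sqrt (alpha_l A)) * (q0 * pi * lam * erf lam * F\<^sub>1 (c A * lam))"
        by simp
      show ?thesis
        unfolding e[symmetric] D(4) F_def using pos by (simp add: real_sqrt_mult field_simps)
    qed
    ultimately show ?thesis by linarith
  qed
  then have "Tk = G A T1 lam"
    unfolding G_def using den by (simp add: eq_divide_eq algebra_simps)
  then show ?thesis using p by (auto simp: rubinstein_pair_def similarity_pair_def)
qed

text \<open>The choice of \<open>T1\<close> makes the slopes \<open>(Tk - T1) / erf \<lambda>\<close> and \<open>(q0 / k_s) sqrt(\<pi> \<alpha>_s)\<close> agree.\<close>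

lemma rubinstein_Ts_eq_similarity_Ts:
  assumes lam: "0 < lam" and T1: "T1 = Tk - q0 / k_s A * sqrt (alpha_s A * pi) * erf lam"
  shows "rubinstein_Ts A T1 lam Tk = similarity_Ts A q0 lam Tk"
  using erf_pos[OF lam] by (intro ext) (simp add: rubinstein_Ts_def similarity_Ts_def T1 mult_ac)

theorem theorem3p1:
  fixes A :: alloy and q0 lam Tk T1 :: real
  assumes data: "alloy_data A"
    and q0_pos: "0 < q0"
    and q0_lower: "(T_0 A - T_0l A) * k_l A / sqrt (pi * alpha_l A) < q0"
    and q0_upper: "q0 < (T_0 A - T_0s A) * k_l A / sqrt (pi * alpha_l A)"
    and pair: "similarity_pair A q0 lam Tk"
    and T1: "T1 = Tk - q0 / k_s A * sqrt (alpha_s A * pi) * erf lam"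
  shows "(\<forall>t>0. similarity_Ts A q0 lam Tk 0 t = T1) \<and>
    problem_P1 A q0 (front A lam) Tk
      (similarity_Ts A q0 lam Tk) (profile_Tl A lam Tk) (profile_Cs A Tk) (profile_Cl A lam Tk) \<and>
    (\<exists>mu Tk'. rubinstein_pair A T1 mu Tk') \<and>
    (\<forall>mu Tk'. rubinstein_pair A T1 mu Tk' \<longrightarrow>
       problem_PR A T1 (front A mu) Tk'
         (rubinstein_Ts A T1 mu Tk') (profile_Tl A mu Tk') (profile_Cs A Tk') (profile_Cl A mu Tk') \<and>
       mu = lam \<and> Tk' = Tk \<and>
       (\<forall>t>0. front A lam t = front A mu t \<and>
         (\<forall>x. 0 < x \<and> x < front A lam t \<longrightarrow>
            similarity_Ts A q0 lam Tk x t = rubinstein_Ts A T1 mu Tk' x t \<and>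
            profile_Cs A Tk x t = profile_Cs A Tk' x t) \<and>
         (\<forall>x. front A lam t < x \<longrightarrow>
            profile_Tl A lam Tk x t = profile_Tl A mu Tk' x t \<and>
            profile_Cl A lam Tk x t = profile_Cl A mu Tk' x t)))"
proof -
  note D = similarity_pairD[OF data pair]
  have pos: "0 < alpha_s A" "0 < k_s A" using data by (auto simp: alloy_data_def)
  have T1_less: "T1 < T_0 A"
  proof -
    have "0 < q0 / k_s A * sqrt (alpha_s A * pi) * erf lam"
      using q0_pos pos erf_pos[OF D(1)] by simp
    then show ?thesis using D(7) T1 by simp
  qed
  have solid: "solidification A (front A lam) Tk
    (similarity_Ts A q0 lam Tk) (profile_Tl A lam Tk) (profile_Cs A Tk) (profile_Cl A lam Tk)"
    by (rule similarity_solidification[OF data pair])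
  have face: "\<forall>t>0. similarity_Ts A q0 lam Tk 0 t = T1"
    by (simp add: similarity_Ts_def T1 mult.commute)
  have P1: "problem_P1 A q0 (front A lam) Tk
      (similarity_Ts A q0 lam Tk) (profile_Tl A lam Tk) (profile_Cs A Tk) (profile_Cl A lam Tk)"
    unfolding problem_P1_def using solid similarity_Ts_flux[OF data] by blast
  have rpair: "rubinstein_pair A T1 lam Tk"
    by (rule similarity_imp_rubinstein_pair[OF data pair T1])
  have Ts: "rubinstein_Ts A T1 lam Tk = similarity_Ts A q0 lam Tk"
    by (rule rubinstein_Ts_eq_similarity_Ts[OF D(1) T1])
  have PR: "problem_PR A T1 (front A lam) Tk
      (rubinstein_Ts A T1 lam Tk) (profile_Tl A lam Tk) (profile_Cs A Tk) (profile_Cl A lam Tk)"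
    unfolding problem_PR_def Ts
  proof (intro conjI allI impI solid)
    fix t :: real assume t: "0 < t"
    have "((\<lambda>x. similarity_Ts A q0 lam Tk x t) \<longlongrightarrow> similarity_Ts A q0 lam Tk 0 t) (at_right 0)"
      unfolding similarity_Ts_eq
      by (rule tendsto_eq_rhs[OF erf_profile_tendsto[OF pos(1) t]]) (simp add: erf_profile_def)
    then show "((\<lambda>x. similarity_Ts A q0 lam Tk x t) \<longlongrightarrow> T1) (at_right 0)"
      using face t by simp
  qed
  have uniq: "mu = lam \<and> Tk' = Tk" if "rubinstein_pair A T1 mu Tk'" for mu Tk'
    by (rule rubinstein_pair_unique[OF data T1_less that rpair])
  have concl: "problem_PR A T1 (front A mu) Tk'
         (rubinstein_Ts A T1 mu Tk') (profile_Tl A mu Tk') (profile_Cs A Tk') (profile_Cl A mu Tk') \<and>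
       mu = lam \<and> Tk' = Tk \<and>
       (\<forall>t>0. front A lam t = front A mu t \<and>
         (\<forall>x. 0 < x \<and> x < front A lam t \<longrightarrow>
            similarity_Ts A q0 lam Tk x t = rubinstein_Ts A T1 mu Tk' x t \<and>
            profile_Cs A Tk x t = profile_Cs A Tk' x t) \<and>
         (\<forall>x. front A lam t < x \<longrightarrow>
            profile_Tl A lam Tk x t = profile_Tl A mu Tk' x t \<and>
            profile_Cl A lam Tk x t = profile_Cl A mu Tk' x t))"
    if "rubinstein_pair A T1 mu Tk'" for mu Tk'
  proof -
    from uniq[OF that] have "mu = lam" "Tk' = Tk" by auto
    then show ?thesis using PR Ts by simp
  qed
  show ?thesis using face P1 rpair concl by blast
qed

end
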